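(* Let $\delta>0$ and $\eta>0$ be such that $$\sigma_{\eta,0}\leqslant -\ln(2)+\delta .$$ Then there exists $\varepsilon_1>0$ such that for any $\varepsilon\in(-\varepsilon_1,\varepsilon_1)$ the maximal spectral abscissa $\sigma_{\eta,\varepsilon}=\sup\{\operatorname{Re}(s): s\in\mathcal{S}_{\eta,\varepsilon}\}$ satisfies $$\sigma_{\eta,\varepsilon}\leqslant -\ln(2)+2\delta .$$
   Context: Let $\eta>0$ (viscosity) and let $\varepsilon\in\mathbb{R}$ (a perturbation of the nominal transport velocity $1$). For $s\in\mathbb{C}$ set $$\lambda_1(s)=\frac{(1+\varepsilon)+\sqrt{(1+\varepsilon)^2+4\eta s}}{2\eta},\qquad \lambda_2(s)=\frac{(1+\varepsilon)-\sqrt{(1+\varepsilon)^2+4\eta s}}{2\eta},$$ where $\sqrt{\cdot}$ is the principal value of the square root, and $$f_{\eta,\varepsilon}(s)=\frac{\lambda_1(s)-\lambda_2(s)}{\lambda_1(s)e^{-\lambda_2(s)}-\lambda_2(s)e^{-\lambda_1(s)}} .$$ (The expression for $f_{\eta,\varepsilon}$ is symmetric under exchange of $\lambda_1$ and $\lambda_2$, so its value does not depend on the choice of the square root.) The spectrum $\mathcal{S}_{\eta,\varepsilon}$ is the set of roots $s\in\mathbb{C}$ of the characteristic equation $$f_{\eta,\varepsilon}^2(s)-f_{\eta,\varepsilon}(s)e^{-s}-1=0,$$ where the point $s=-(1+\varepsilon)^2/(4\eta)$, at which $\lambda_1=\lambda_2$ and both numerator and denominator of $f_{\eta,\varepsilon}$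 vanish, is by convention counted as an element of $\mathcal{S}_{\eta,\varepsilon}$. Origin: this is the characteristic equation of the closed loop system $\partial_t y_i+(1+\varepsilon)\partial_x y_i-\eta\,\partial_{xx}^2y_i=0$ ($i=1,2$, $x\in(0,1)$), $y_1(t,0)=y_2(t,1)+U(t)$, $y_2(t,0)=y_1(t,1)$, $\partial_xy_1(t,1)=\partial_xy_2(t,1)=0$, with the output feedback $U(t)=-y_1(t-1,1)$, in which the controller uses the nominal delay $1$. *)

theory Defs
  imports Complex_Main "HOL-Library.Extended_Real"
begin

definition lambda1 :: "real \<Rightarrow> real \<Rightarrow> complex \<Rightarrow> complex" where
  "lambda1 \<eta> \<epsilon> s =
     (complex_of_real (1 + \<epsilon>) + csqrt (complex_of_real ((1 + \<epsilon>)\<^sup>2) + 4 * complex_of_real \<eta> * s))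
       / complex_of_real (2 * \<eta>)"

definition lambda2 :: "real \<Rightarrow> real \<Rightarrow> complex \<Rightarrow> complex" where
  "lambda2 \<eta> \<epsilon> s =
     (complex_of_real (1 + \<epsilon>) - csqrt (complex_of_real ((1 + \<epsilon>)\<^sup>2) + 4 * complex_of_real \<eta> * s))
       / complex_of_real (2 * \<eta>)"

definition transfer_f :: "real \<Rightarrow> real \<Rightarrow> complex \<Rightarrow> complex" where
  "transfer_f \<eta> \<epsilon> s =
     (lambda1 \<eta> \<epsilon> s - lambda2 \<eta> \<epsilon> s) /
     (lambda1 \<eta> \<epsilon> s * exp (- lambda2 \<eta> \<epsilon> s) - lambda2 \<eta> \<epsilon> s * exp (- lambda1 \<eta> \<epsilon> s))"

(* The first disjunct is the point where the two lambdas coincide; it belongs to the spectrum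
   by convention.  Where the denominator of transfer_f vanishes, HOL's x / 0 = 0 makes the
   left-hand side of the characteristic equation equal to -1, so no spurious roots arise there. *)
definition spectrum :: "real \<Rightarrow> real \<Rightarrow> complex set" where
  "spectrum \<eta> \<epsilon> =
     {s. s = complex_of_real (- ((1 + \<epsilon>)\<^sup>2 / (4 * \<eta>))) \<or>
         (transfer_f \<eta> \<epsilon> s)\<^sup>2 - transfer_f \<eta> \<epsilon> s * exp (- s) - 1 = 0}"

(* The supremum is taken in the extended reals, so that an upper bound on it is meaningful
   without knowing in advance that the spectrum is bounded to the right. *)
definition spectral_abscissa :: "real \<Rightarrow> real \<Rightarrow> ereal" where
  "spectral_abscissa \<eta> \<epsilon> = (SUP s \<in> spectrum \<eta> \<epsilon>. ereal (Re s))"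

end

theory Submission
  imports Defs "HOL-Analysis.Topology_Euclidean_Space"
begin

text \<open>
  The estimate passes to small perturbations by compactness. Suppose that it fails for
  velocities \<open>c = 1 + \<epsilon>\<close> arbitrarily close to \<open>1\<close>: there are \<open>\<epsilon>\<^sub>n \<longlonglongrightarrow> 0\<close> and spectral points \<open>s\<^sub>n\<close> with
  real part above \<open>- ln 2 + 2\<delta>\<close>. If the \<open>s\<^sub>n\<close> stay bounded, a limit point lies in the
  spectrum for \<open>\<epsilon> = 0\<close> and has real part at least \<open>- ln 2 + 2\<delta>\<close>, which exceeds the assumed bound
  \<open>- ln 2 + \<delta>\<close>.

  Both ingredients, boundedness and the closedness of the spectrum under limits, become
  simple in the coordinate \<open>r\<close> with \<open>r\<^sup>2 = c\<^sup>2 + 4\<eta>s\<close>, of which \<open>s\<close> is a polynomial function.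
  In it \<open>f = 2r / N(r)\<close> for an odd entire function \<open>N\<close>, and after clearing denominators the
  characteristic equation is \<open>N\<^sup>2 + 2rN e\<^sup>-\<^sup>s - 4r\<^sup>2 = 0\<close>. Its left-hand side is entire, is even in
  \<open>r\<close>, so that it does not see the branch of the root, and vanishes at \<open>r = 0\<close>, so that
  the point where \<open>\<lambda>\<^sub>1 = \<lambda>\<^sub>2\<close> belongs to the zero set exactly as the convention demands
  (\<open>mem_spectrum_iff\<close>).

  For boundedness, \<open>\<bar>e\<^sup>-\<^sup>s\<bar>\<close> is bounded on a right half-plane. There the equation forces
  \<open>N/r\<close> to be bounded, while \<open>N/r\<close> grows exponentially with \<open>Re r\<close>; hence \<open>Re r\<close> is bounded
  (\<open>exp_Re_root_le\<close>). As \<open>Re (r\<^sup>2) = (Re r)\<^sup>2 - (Im r)\<^sup>2\<close> is bounded below on the half-plane, the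
  bound on \<open>Re r\<close> entails one on \<open>Im r\<close>.
\<close>

text \<open>
  Up to the factor \<open>2\<eta>\<close> this is the denominator
  \<open>\<lambda>\<^sub>1 e\<^bsup>-\<lambda>\<^sub>2\<^esup> - \<lambda>\<^sub>2 e\<^bsup>-\<lambda>\<^sub>1\<^esup>\<close> of the transfer function, with \<open>c = 1 + \<epsilon>\<close> and \<open>r\<close> the square root.
\<close>
definition transfer_denom :: "real \<Rightarrow> real \<Rightarrow> complex \<Rightarrow> complex" where
  "transfer_denom \<eta> c r =
     exp (- complex_of_real (c / (2 * \<eta>))) *
       ((r + complex_of_real c) * exp (r / complex_of_real (2 * \<eta>)) +
        (r - complex_of_real c) * exp (- (r / complex_of_real (2 * \<eta>))))"

definition char_fun :: "real \<Rightarrow> real \<Rightarrow> complex \<Rightarrow> complex \<Rightarrow> complex" where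
  "char_fun \<eta> c r s =
     (transfer_denom \<eta> c r)\<^sup>2 + 2 * r * transfer_denom \<eta> c r * exp (- s) - 4 * r\<^sup>2"

lemma transfer_denom_minus: "transfer_denom \<eta> c (- r) = - transfer_denom \<eta> c r"
  by (simp add: transfer_denom_def algebra_simps)

lemma char_fun_minus: "char_fun \<eta> c (- r) s = char_fun \<eta> c r s"
  by (simp add: char_fun_def transfer_denom_minus)

lemma transfer_denom_0: "transfer_denom \<eta> c 0 = 0"
  by (simp add: transfer_denom_def)

lemma transfer_f_eq:
  fixes \<eta> \<epsilon> :: real and s :: complex
  assumes "\<eta> > 0"
  defines "r \<equiv> csqrt (complex_of_real ((1 + \<epsilon>)\<^sup>2) + 4 * complex_of_real \<eta> * s)"
  shows "transfer_f \<eta> \<epsilon> s = 2 * r / transfer_denom \<eta> (1 + \<epsilon>) r"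
proof -
  define h where "h = complex_of_real (2 * \<eta>)"
  define c where "c = complex_of_real (1 + \<epsilon>)"
  have h: "h \<noteq> 0"
    using assms(1) by (simp add: h_def)
  have l: "lambda1 \<eta> \<epsilon> s = (c + r) / h" "lambda2 \<eta> \<epsilon> s = (c - r) / h"
    by (simp_all add: lambda1_def lambda2_def r_def h_def c_def)
  have N: "transfer_denom \<eta> (1 + \<epsilon>) r = exp (- (c / h)) * ((r + c) * exp (r / h) + (r - c) * exp (- (r / h)))"
    by (simp add: transfer_denom_def h_def c_def)
  have e: "exp (- ((c - r) / h)) = exp (- (c / h)) * exp (r / h)"
    "exp (- ((c + r) / h)) = exp (- (c / h)) * exp (- (r / h))"
    by (simp_all add: exp_add [symmetric] diff_divide_distrib add_divide_distrib)
  have "lambda1 \<eta> \<epsilon> s * exp (- lambda2 \<eta> \<epsilon> s) - lambda2 \<eta> \<epsilon> s * exp (- lambda1 \<eta> \<epsilon> s)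
      = transfer_denom \<eta> (1 + \<epsilon>) r / h"
    unfolding l e N using h by (simp add: field_simps)
  moreover have "lambda1 \<eta> \<epsilon> s - lambda2 \<eta> \<epsilon> s = 2 * r / h"
    unfolding l using h by (simp add: field_simps)
  ultimately show ?thesis
    unfolding transfer_f_def using h by simp
qed

text \<open>
  Where \<open>r\<close> and \<open>N\<close> are nonzero the two characteristic functions differ by the factor
  \<open>-1/N\<^sup>2\<close>. A zero of \<open>N\<close> with \<open>r \<noteq> 0\<close> gives no root on either side, since the values there
  are \<open>-1\<close> and \<open>-4r\<^sup>2\<close>. At \<open>r = 0\<close>, the point added by convention, both sides hold.
\<close>
lemma mem_spectrum_iff:
  fixes \<eta> \<epsilon> :: real and r s :: complex
  assumes "\<eta> > 0" and r: "r\<^sup>2 = complex_of_real ((1 + \<epsilon>)\<^sup>2) + 4 * complex_of_real \<eta> * s"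
  shows "s \<in> spectrum \<eta> \<epsilon> \<longleftrightarrow> char_fun \<eta> (1 + \<epsilon>) r s = 0"
proof -
  define q where "q = csqrt (complex_of_real ((1 + \<epsilon>)\<^sup>2) + 4 * complex_of_real \<eta> * s)"
  define N where "N = transfer_denom \<eta> (1 + \<epsilon>) q"
  have q2: "q\<^sup>2 = complex_of_real ((1 + \<epsilon>)\<^sup>2) + 4 * complex_of_real \<eta> * s"
    by (simp add: q_def)
  then have "r = q \<or> r = - q"
    using r by (metis power2_eq_iff)
  then have branch: "char_fun \<eta> (1 + \<epsilon>) r s = char_fun \<eta> (1 + \<epsilon>) q s"
    by (auto simp: char_fun_minus)
  have point: "s = complex_of_real (- ((1 + \<epsilon>)\<^sup>2 / (4 * \<eta>))) \<longleftrightarrow> q = 0"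
  proof -
    have "s = complex_of_real (- ((1 + \<epsilon>)\<^sup>2 / (4 * \<eta>))) \<longleftrightarrow> q\<^sup>2 = 0"
      unfolding q2 using assms(1)
      by (simp add: field_simps eq_neg_iff_add_eq_0 add.commute)
    then show ?thesis by simp
  qed
  have f: "transfer_f \<eta> \<epsilon> s = 2 * q / N"
    unfolding N_def q_def by (rule transfer_f_eq [OF assms(1)])
  show ?thesis
  proof (cases "q = 0")
    case True
    then show ?thesis
      unfolding branch
      by (simp add: point spectrum_def char_fun_def transfer_denom_0 del: of_real_minus)
  next
    case False
    have "(2 * q / N)\<^sup>2 - 2 * q / N * exp (- s) - 1 = 0 \<longleftrightarrow> N\<^sup>2 + 2 * q * N * exp (- s) - 4 * q\<^sup>2 = 0"
    proof (cases "N = 0")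
      case True
      then show ?thesis using False by simp
    next
      case N: False
      have "(2 * q / N)\<^sup>2 - 2 * q / N * exp (- s) - 1 = - (N\<^sup>2 + 2 * q * N * exp (- s) - 4 * q\<^sup>2) / N\<^sup>2"
        using N by (simp add: field_simps power2_eq_square)
      then show ?thesis
        using N by (simp only: divide_eq_0_iff neg_equal_0_iff_equal power_eq_0_iff simp_thms)
    qed
    then show ?thesis
      unfolding branch using False
      by (simp add: point spectrum_def f char_fun_def N_def [symmetric] del: of_real_minus)
  qed
qed

text \<open>
  For \<open>c > 0\<close> the root in the right half-plane is closer to \<open>c\<close> than to \<open>-c\<close>, so the growing
  exponential in \<open>N\<close> also carries the larger coefficient, one of modulus at least \<open>\<bar>r\<bar>\<close>.
\<close>
lemma norm_transfer_denom_ge: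
  assumes "\<eta> > 0" and "c > 0" and "Re r \<ge> 0"
  shows "norm (transfer_denom \<eta> c r) \<ge> exp (- (c / (2 * \<eta>))) * (norm r * (exp (Re r / (2 * \<eta>)) - 1))"
proof -
  define x where "x = Re r / (2 * \<eta>)"
  define E F where "E = exp (r / complex_of_real (2 * \<eta>))" and "F = exp (- (r / complex_of_real (2 * \<eta>)))"
  have x: "x \<ge> 0" using assms by (simp add: x_def)
  have Re: "Re (r / complex_of_real (2 * \<eta>)) = x"
    unfolding x_def by (rule Re_divide_of_real)
  have nE: "norm E = exp x" and nF: "norm F = exp (- x)"
    unfolding E_def F_def by (simp_all only: norm_exp_eq_Re uminus_complex.sel Re)
  have closer: "norm (r - of_real c) \<le> norm (r + of_real c)"
    unfolding cmod_def using assms by (auto intro!: real_sqrt_le_mono simp: power2_eq_square algebra_simps)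
  have larger: "norm r \<le> norm (r + of_real c)"
    unfolding cmod_def using assms by (auto intro!: real_sqrt_le_mono simp: power2_eq_square algebra_simps)
  have "norm r * (exp x - 1) \<le> norm (r + of_real c) * (exp x - 1)"
    using larger x by (intro mult_right_mono) auto
  also have "\<dots> = norm (r + of_real c) * exp x - norm (r + of_real c) * 1"
    by (simp add: algebra_simps)
  also have "\<dots> \<le> norm (r + of_real c) * exp x - norm (r - of_real c) * exp (- x)"
    using closer x by (intro diff_left_mono mult_mono) auto
  also have "\<dots> \<le> norm ((r + of_real c) * E + (r - of_real c) * F)"
    using norm_diff_ineq [of "(r + of_real c) * E" "(r - of_real c) * F"]
    by (simp add: norm_mult nE nF)
  finally have "norm r * (exp x - 1) \<le> norm ((r + of_real c) * E + (r - of_real c) * F)" .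
  moreover have "norm (exp (- complex_of_real (c / (2 * \<eta>)))) = exp (- (c / (2 * \<eta>)))"
    by (simp only: norm_exp_eq_Re uminus_complex.sel Re_complex_of_real)
  ultimately show ?thesis
    unfolding transfer_denom_def E_def [symmetric] F_def [symmetric] x_def [symmetric] norm_mult
    by (simp add: mult_left_mono)
qed

text \<open>
  The equation reads \<open>(N/2r) (N/2r + e\<^sup>-\<^sup>s) = 1\<close>, which is impossible once \<open>\<bar>N/2r\<bar>\<close> exceeds
  \<open>\<bar>e\<^sup>-\<^sup>s\<bar> + 1\<close>.
\<close>
lemma norm_transfer_denom_le:
  assumes root: "char_fun \<eta> c r s = 0" and M: "norm (exp (- s)) \<le> M"
  shows "norm (transfer_denom \<eta> c r) \<le> 2 * norm r * (M + 1)"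
proof (rule ccontr)
  define N where "N = transfer_denom \<eta> c r"
  assume "\<not> norm (transfer_denom \<eta> c r) \<le> 2 * norm r * (M + 1)"
  then have big: "2 * norm r * M + 2 * norm r < norm N"
    by (simp add: N_def algebra_simps)
  have M0: "0 \<le> M" using M norm_ge_zero order_trans by blast
  have "N * (N + 2 * r * exp (- s)) = 4 * r\<^sup>2"
    using root by (simp add: char_fun_def N_def power2_eq_square algebra_simps)
  then have eq: "norm N * norm (N + 2 * r * exp (- s)) = (2 * norm r) * (2 * norm r)"
    by (metis norm_mult norm_numeral norm_power power2_eq_square mult.assoc mult.left_commute
        numeral_Bit0 mult_2_right mult_2 distrib_right)
  have "norm (2 * r * exp (- s)) \<le> 2 * norm r * M"
    using M by (simp add: norm_mult mult_left_mono)
  then have "2 * norm r < norm (N + 2 * r * exp (- s))"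
    using big norm_diff_ineq [of N "2 * r * exp (- s)"] by linarith
  moreover have "2 * norm r < norm N"
    using big M0 by (smt (verit) mult_nonneg_nonneg norm_ge_zero)
  ultimately have "(2 * norm r) * (2 * norm r) < norm N * norm (N + 2 * r * exp (- s))"
    by (intro mult_strict_mono') auto
  then show False using eq by simp
qed

lemma exp_Re_root_le:
  assumes "\<eta> > 0" and "c > 0" and "Re r \<ge> 0"
    and root: "char_fun \<eta> c r s = 0" and M: "norm (exp (- s)) \<le> M"
  shows "exp (Re r / (2 * \<eta>)) \<le> 1 + 2 * (M + 1) * exp (c / (2 * \<eta>))"
proof (cases "r = 0")
  case True
  have "0 \<le> M" using M norm_ge_zero order_trans by blast
  then show ?thesis using True by simp
next
  case False
  have "exp (- (c / (2 * \<eta>))) * (norm r * (exp (Re r / (2 * \<eta>)) - 1)) \<le> 2 * norm r * (M + 1)"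
    using norm_transfer_denom_ge [OF assms(1-3)] norm_transfer_denom_le [OF root M] by linarith
  then have "norm r * (exp (Re r / (2 * \<eta>)) - 1) \<le> norm r * (2 * (M + 1) * exp (c / (2 * \<eta>)))"
    by (simp add: exp_minus field_simps)
  then show ?thesis using False by simp
qed

text \<open>
  The bound is uniform for velocities \<open>c\<close> in \<open>(0, 2]\<close>, because \<open>c\<close> enters the estimate of
  \<open>Re r\<close> only through \<open>exp (c/2\<eta>)\<close> and the lower bound for \<open>Re (r\<^sup>2)\<close> only through \<open>c\<^sup>2 \<ge> 0\<close>.
\<close>
lemma spectral_roots_bounded:
  fixes \<eta> a :: real
  assumes "\<eta> > 0"
  obtains B where "\<And>c r s. \<lbrakk>0 < c; c \<le> 2; Re r \<ge> 0; Re s \<ge> a; char_fun \<eta> c r s = 0;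
      r\<^sup>2 = complex_of_real (c\<^sup>2) + 4 * complex_of_real \<eta> * s\<rbrakk> \<Longrightarrow> norm r \<le> B"
proof -
  define L where "L = 1 + 2 * (exp (- a) + 1) * exp (2 / (2 * \<eta>))"
  define X where "X = 2 * \<eta> * ln L"
  have L: "L > 0" by (simp add: L_def add_pos_pos)
  have "norm r \<le> sqrt (2 * X\<^sup>2 + 4 * \<eta> * \<bar>a\<bar>)"
    if c: "0 < c" "c \<le> 2" and r: "Re r \<ge> 0" and s: "Re s \<ge> a" and root: "char_fun \<eta> c r s = 0"
      and rs: "r\<^sup>2 = complex_of_real (c\<^sup>2) + 4 * complex_of_real \<eta> * s" for c r s
  proof -
    have "norm (exp (- s)) \<le> exp (- a)" using s by simp
    then have "exp (Re r / (2 * \<eta>)) \<le> 1 + 2 * (exp (- a) + 1) * exp (c / (2 * \<eta>))"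
      by (rule exp_Re_root_le [OF assms c(1) r root])
    also have "\<dots> \<le> L"
      unfolding L_def using assms c
      by (intro add_left_mono mult_left_mono exp_le_cancel_iff [THEN iffD2] divide_right_mono) auto
    finally have "Re r / (2 * \<eta>) \<le> ln L"
      using L by (simp add: ln_ge_iff)
    then have "Re r \<le> X" using assms by (simp add: X_def field_simps)
    then have X: "(Re r)\<^sup>2 \<le> X\<^sup>2" using r by (rule power_mono)
    have "Re (r\<^sup>2) = c\<^sup>2 + 4 * \<eta> * Re s" unfolding rs by simp
    then have "(Re r)\<^sup>2 - (Im r)\<^sup>2 = c\<^sup>2 + 4 * \<eta> * Re s"
      by (simp only: Re_power2)
    moreover have "4 * \<eta> * Re s \<ge> - (4 * \<eta> * \<bar>a\<bar>)"
    proof -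
      have "4 * \<eta> * (- \<bar>a\<bar>) \<le> 4 * \<eta> * Re s" using s assms by (intro mult_left_mono) auto
      then show ?thesis by simp
    qed
    ultimately have "(Im r)\<^sup>2 \<le> X\<^sup>2 + 4 * \<eta> * \<bar>a\<bar>" using X zero_le_power2 [of c] by linarith
    then show ?thesis
      unfolding cmod_def using X by (intro real_sqrt_le_mono) linarith
  qed
  then show thesis by (rule that)
qed

theorem theorem2:
  fixes \<delta> \<eta> :: real
  assumes "\<delta> > 0" and "\<eta> > 0"
    and "spectral_abscissa \<eta> 0 \<le> ereal (- ln 2 + \<delta>)"
  shows "\<exists>\<epsilon>1>0. \<forall>\<epsilon>\<in>{-\<epsilon>1<..<\<epsilon>1}. spectral_abscissa \<eta> \<epsilon> \<le> ereal (- ln 2 + 2 * \<delta>)"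
proof (rule ccontr)
  define a where "a = - ln 2 + 2 * \<delta>"
  assume contra: "\<not> ?thesis"
  have "\<exists>\<epsilon> s. \<bar>\<epsilon>\<bar> < inverse (real (Suc n)) \<and> s \<in> spectrum \<eta> \<epsilon> \<and> a < Re s" for n
  proof -
    have "inverse (real (Suc n)) > 0" by simp
    with contra obtain \<epsilon> where "\<epsilon> \<in> {- inverse (real (Suc n))<..<inverse (real (Suc n))}"
      and "\<not> spectral_abscissa \<eta> \<epsilon> \<le> ereal a"
      unfolding a_def by blast
    moreover from this(2) obtain s where "s \<in> spectrum \<eta> \<epsilon>" "a < Re s"
      unfolding spectral_abscissa_def SUP_le_iff by (auto simp: not_le)
    ultimately show ?thesis by (intro exI [of _ \<epsilon>] exI [of _ s]) auto
  qed
  then obtain \<epsilon> s where eps: "\<And>n. \<bar>\<epsilon> n\<bar> < inverse (real (Suc n))"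
    and spec: "\<And>n. s n \<in> spectrum \<eta> (\<epsilon> n)" and Re_s: "\<And>n. a < Re (s n)"
    by metis
  have eps0: "\<epsilon> \<longlonglongrightarrow> 0"
    using eps by (intro Lim_null_comparison [OF _ LIMSEQ_inverse_real_of_nat])
      (auto intro!: always_eventually less_imp_le)
  have eps1: "\<bar>\<epsilon> n\<bar> < 1" for n
  proof -
    have "inverse (real (Suc n)) \<le> 1" by (simp add: field_simps)
    then show ?thesis using eps [of n] by linarith
  qed
  define r where "r n = csqrt (complex_of_real ((1 + \<epsilon> n)\<^sup>2) + 4 * complex_of_real \<eta> * s n)" for n
  have r2: "(r n)\<^sup>2 = complex_of_real ((1 + \<epsilon> n)\<^sup>2) + 4 * complex_of_real \<eta> * s n" for n
    by (simp add: r_def)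
  have root: "char_fun \<eta> (1 + \<epsilon> n) (r n) (s n) = 0" for n
    using spec [of n] mem_spectrum_iff [OF assms(2) r2] by blast
  have Re_r: "Re (r n) \<ge> 0" for n
    unfolding r_def using csqrt_principal
    by (metis less_eq_real_def)
  (* The limit point is extracted in the coordinate r, not s: the principal square root jumps
     across its cut, whereas s depends continuously on r. *)
  obtain B where B: "\<And>c r s. \<lbrakk>0 < c; c \<le> 2; Re r \<ge> 0; Re s \<ge> a; char_fun \<eta> c r s = 0;
      r\<^sup>2 = complex_of_real (c\<^sup>2) + 4 * complex_of_real \<eta> * s\<rbrakk> \<Longrightarrow> norm r \<le> B"
    using spectral_roots_bounded [OF assms(2), of a] by blast
  have "norm (r n) \<le> B" for n
    using eps1 [of n] Re_s [of n] by (intro B [OF _ _ Re_r _ root r2]) auto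
  then have "bounded (range r)"
    unfolding bounded_iff by auto
  then obtain l k where k: "strict_mono (k :: nat \<Rightarrow> nat)" and l: "(r \<circ> k) \<longlonglongrightarrow> l"
    using bounded_imp_convergent_subsequence by blast
  define z where "z = (l\<^sup>2 - 1) / (4 * complex_of_real \<eta>)"
  have r_lim: "(\<lambda>n. r (k n)) \<longlonglongrightarrow> l" using l by (simp add: o_def)
  have eps_lim: "(\<lambda>n. \<epsilon> (k n)) \<longlonglongrightarrow> 0"
    using LIMSEQ_subseq_LIMSEQ [OF eps0 k] by (simp add: o_def)
  have s_eq: "s n = ((r n)\<^sup>2 - complex_of_real ((1 + \<epsilon> n)\<^sup>2)) / (4 * complex_of_real \<eta>)" for n
    using assms(2) by (simp add: r2)
  have "(\<lambda>n. ((r (k n))\<^sup>2 - complex_of_real ((1 + \<epsilon> (k n))\<^sup>2)) / (4 * complex_of_real \<eta>))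
      \<longlonglongrightarrow> (l\<^sup>2 - complex_of_real ((1 + 0)\<^sup>2)) / (4 * complex_of_real \<eta>)"
    using assms(2) by (intro tendsto_intros r_lim eps_lim) auto
  then have s_lim: "(\<lambda>n. s (k n)) \<longlonglongrightarrow> z"
    unfolding s_eq [symmetric] by (simp add: z_def)
  have "(\<lambda>n. char_fun \<eta> (1 + \<epsilon> (k n)) (r (k n)) (s (k n))) \<longlonglongrightarrow> char_fun \<eta> (1 + 0) l z"
    unfolding char_fun_def transfer_denom_def
    using assms(2) by (intro tendsto_intros r_lim eps_lim s_lim) auto
  then have "char_fun \<eta> (1 + 0) l z = 0"
    by (simp only: root) (metis LIMSEQ_unique tendsto_const)
  moreover have "l\<^sup>2 = complex_of_real ((1 + 0)\<^sup>2) + 4 * complex_of_real \<eta> * z"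
    using assms(2) by (simp add: z_def)
  ultimately have "z \<in> spectrum \<eta> 0"
    using mem_spectrum_iff [OF assms(2)] by blast
  then have "ereal (Re z) \<le> spectral_abscissa \<eta> 0"
    unfolding spectral_abscissa_def by (rule SUP_upper)
  also note assms(3)
  finally have "Re z \<le> - ln 2 + \<delta>" by simp
  moreover have "a \<le> Re z"
    using tendsto_Re [OF s_lim] Re_s by (intro LIMSEQ_le_const) (auto intro: less_imp_le)
  ultimately show False
    using assms(1) by (simp add: a_def)
qed

end
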